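(* Let $\mathcal{C}$ be a $d$-uniform E-chordal clutter. Then the simplicial complex $\mathcal{I}(c_d(\mathcal{C}))^\vee$ is strongly shellable.
   Context: A clutter $\mathcal{C}$ with finite vertex set $\mathcal{V}(\mathcal{C})$ consists of a collection $\mathcal{E}(\mathcal{C})$ of nonempty subsets of $\mathcal{V}(\mathcal{C})$ (edges), none of which is included in another. It is $d$-uniform if all edges have cardinality $d$ (here $d\geq 1$). The $d$-complete clutter $K_n^d$ is the clutter on $n$ vertices whose edges are all $d$-element subsets of the vertex set; if $n<d$, it is $n$ isolated points with no edge. E-chordal clutters are the $d$-uniform clutters obtained inductively as follows: (a) each $K_n^d$ is E-chordal; (b) if $\mathcal{K}$ is E-chordal, then so is $\mathcal{C}=\mathcal{K}\cup_{K_j^d}K_i^d$ for $0\le j<i$, i.e. the clutter obtained by attaching $K_i^d$ to $\mathcal{K}$ by identifying a common $K_j^d$ (a set of $j$ vertices of $\mathcal{K}$ inducing a $K_j^d$ in $\mathcal{K}$ is identified with $j$ vertices of $K_i^d$, with no other identification; the vertex set and edge set of $\mathcal{C}$ are the unions of those of $\mathcal{K}$ and $K_i^d$). For an integer $d$, $c_d(\mathcal{C})$ is the clutter on $\mathcal{V}(\mathcal{C})$ with edge set $\{e\subseteq\mathcal{V}(\mathcal{C}): |e|=d,\ e\notin\mathcal{E}(\mathcal{C})\}$. The independence complex $\mathcal{I}(\mathcal{C})$ of a clutter is the simplicial complex of all subsets of $\mathcal{V}(\mathcal{C})$ containing no edge of $\mathcal{C}$. For a simplicial complex $\Delta$ on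 $V$, the Alexander dual is $\Delta^\vee=\{V\setminus F: F\subseteq V, F\notin\Delta\}$. Thus $\mathcal{I}(c_d(\mathcal{C}))^\vee$ is the pure complex whose facets are the sets $\mathcal{V}(\mathcal{C})\setminus e$ with $e\in\mathcal{E}(c_d(\mathcal{C}))$. A simplicial complex is strongly shellable if its facets can be arranged in a linear order $F_1,\dots,F_t$ such that for each pair $i<j$ there exists $k<j$ with $|F_j\setminus F_k|=1$ and $F_i\cap F_j\subseteq F_k\subseteq F_i\cup F_j$. The complex with no faces is (vacuously) strongly shellable. *)

theory Defs
  imports Main
begin

section \<open>Clutters\<close>

record 'a clutter =
  verts :: "'a set"
  edges :: "'a set set"

definition is_clutter :: "'a clutter \<Rightarrow> bool" where
  "is_clutter C \<longleftrightarrow>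
     finite (verts C) \<and>
     (\<forall>e\<in>edges C. e \<noteq> {} \<and> e \<subseteq> verts C) \<and>
     (\<forall>e\<in>edges C. \<forall>f\<in>edges C. e \<subseteq> f \<longrightarrow> e = f)"

definition uniform :: "nat \<Rightarrow> 'a clutter \<Rightarrow> bool" where
  "uniform d C \<longleftrightarrow> (\<forall>e\<in>edges C. card e = d)"

definition complete_clutter :: "nat \<Rightarrow> 'a set \<Rightarrow> 'a clutter" where
  "complete_clutter d S = \<lparr>verts = S, edges = {e. e \<subseteq> S \<and> card e = d}\<rparr>"

definition induced_clutter :: "'a clutter \<Rightarrow> 'a set \<Rightarrow> 'a clutter" where
  "induced_clutter C W = \<lparr>verts = W, edges = {e \<in> edges C. e \<subseteq> W}\<rparr>"

definition clutter_union :: "'a clutter \<Rightarrow> 'a clutter \<Rightarrow> 'a clutter" where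
  "clutter_union C D = \<lparr>verts = verts C \<union> verts D, edges = edges C \<union> edges D\<rparr>"

text \<open>
  The identification of a common $K_j^d$ is realised inside the vertex type: the attached
  complete clutter lives on a finite set \<open>S\<close> that meets the vertices of \<open>K\<close> exactly in the
  set that is identified. The numbers $i$ and $j$ are \<open>card S\<close> and \<open>card (verts K \<inter> S)\<close>,
  and $j < i$ says that \<open>S\<close> is not contained in \<open>verts K\<close>. The intersection may be empty
  ($j = 0$), and both cardinalities may be smaller than \<open>d\<close>.
\<close>

inductive e_chordal :: "nat \<Rightarrow> 'a clutter \<Rightarrow> bool" for d :: nat where
  complete: "finite S \<Longrightarrow> e_chordal d (complete_clutter d S)"
| attach: "e_chordal d K \<Longrightarrow> finite S \<Longrightarrow>
     induced_clutter K (verts K \<inter> S) = complete_clutter d (verts K \<inter> S) \<Longrightarrow>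
     card (verts K \<inter> S) < card S \<Longrightarrow>
     e_chordal d (clutter_union K (complete_clutter d S))"

lemma e_chordal_uniform_clutter:
  assumes "e_chordal d C" and "d \<ge> 1"
  shows "is_clutter C" and "uniform d C"
proof -
  have "finite (verts C) \<and> (\<forall>e\<in>edges C. e \<subseteq> verts C \<and> card e = d)"
    using assms(1)
    by induction (auto simp: complete_clutter_def clutter_union_def)
  then have fin: "finite (verts C)"
    and e: "\<And>e. e \<in> edges C \<Longrightarrow> e \<subseteq> verts C \<and> card e = d" by auto
  show "uniform d C" using e by (simp add: uniform_def)
  have "e = f" if "e \<in> edges C" "f \<in> edges C" "e \<subseteq> f" for e f
    using that e fin by (metis card_subset_eq finite_subset)
  moreover have "e \<noteq> {}" if "e \<in> edges C" for e
    using e[OF that] assms(2) by auto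
  ultimately show "is_clutter C" using fin e by (auto simp: is_clutter_def)
qed

definition d_complement :: "nat \<Rightarrow> 'a clutter \<Rightarrow> 'a clutter" where
  "d_complement d C =
     \<lparr>verts = verts C, edges = {e. e \<subseteq> verts C \<and> card e = d \<and> e \<notin> edges C}\<rparr>"

section \<open>Simplicial complexes\<close>

text \<open>
  Complexes are given by their sets of faces. The complex without any face, not even the
  empty one, is included.
\<close>

definition simplicial_complex :: "'a set \<Rightarrow> 'a set set \<Rightarrow> bool" where
  "simplicial_complex V \<Delta> \<longleftrightarrow>
     finite V \<and> \<Delta> \<subseteq> Pow V \<and> (\<forall>F\<in>\<Delta>. \<forall>G. G \<subseteq> F \<longrightarrow> G \<in> \<Delta>)"

definition facets :: "'a set set \<Rightarrow> 'a set set" where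
  "facets \<Delta> = {F \<in> \<Delta>. \<forall>G\<in>\<Delta>. F \<subseteq> G \<longrightarrow> F = G}"

definition independence_complex :: "'a clutter \<Rightarrow> 'a set set" where
  "independence_complex C = {F. F \<subseteq> verts C \<and> (\<forall>e\<in>edges C. \<not> e \<subseteq> F)}"

definition alexander_dual :: "'a set \<Rightarrow> 'a set set \<Rightarrow> 'a set set" where
  "alexander_dual V \<Delta> = {V - F | F. F \<subseteq> V \<and> F \<notin> \<Delta>}"

definition strongly_shellable :: "'a set set \<Rightarrow> bool" where
  "strongly_shellable \<Delta> \<longleftrightarrow>
     (\<exists>Fs. distinct Fs \<and> set Fs = facets \<Delta> \<and>
       (\<forall>j<length Fs. \<forall>i<j. \<exists>k<j.
          card (Fs ! j - Fs ! k) = 1 \<and>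
          Fs ! i \<inter> Fs ! j \<subseteq> Fs ! k \<and> Fs ! k \<subseteq> Fs ! i \<union> Fs ! j))"

lemma simplicial_complex_alexander_dual:
  assumes "simplicial_complex V \<Delta>"
  shows "simplicial_complex V (alexander_dual V \<Delta>)"
proof -
  have "\<exists>H. G = V - H \<and> H \<subseteq> V \<and> H \<notin> \<Delta>"
    if "G \<subseteq> V - F" "F \<subseteq> V" "F \<notin> \<Delta>" for F G
  proof (intro exI conjI)
    show "G = V - (V - G)" using that by auto
    show "V - G \<subseteq> V" by auto
    have "F \<subseteq> V - G" using that by auto
    then show "V - G \<notin> \<Delta>" using assms that(3) by (auto simp: simplicial_complex_def)
  qed
  then show ?thesis using assms
    by (auto simp: simplicial_complex_def alexander_dual_def)
qed

lemma simplicial_complex_independence_complex: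
  "finite (verts C) \<Longrightarrow> simplicial_complex (verts C) (independence_complex C)"
  by (auto simp: simplicial_complex_def independence_complex_def)

lemma facets_dual_independence_complex:
  assumes "is_clutter C"
  shows "facets (alexander_dual (verts C) (independence_complex C)) = (\<lambda>e. verts C - e) ` edges C"
proof -
  let ?V = "verts C" and ?D = "alexander_dual (verts C) (independence_complex C)"
  have D: "G \<in> ?D \<longleftrightarrow> (\<exists>e\<in>edges C. G \<subseteq> ?V - e)" for G
  proof
    assume "G \<in> ?D"
    then show "\<exists>e\<in>edges C. G \<subseteq> ?V - e"
      by (auto simp: alexander_dual_def independence_complex_def)
  next
    assume "\<exists>e\<in>edges C. G \<subseteq> ?V - e"
    then obtain e where e: "e \<in> edges C" "G \<subseteq> ?V - e" by auto
    then have "G = ?V - (?V - G)" "e \<subseteq> ?V - G"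
      using assms by (auto simp: is_clutter_def)
    then show "G \<in> ?D" using e(1)
      by (auto simp: alexander_dual_def independence_complex_def intro!: exI[of _ "?V - G"])
  qed
  have edge: "e \<subseteq> ?V" if "e \<in> edges C" for e
    using assms that by (auto simp: is_clutter_def)
  have anti: "e = f" if "e \<in> edges C" "f \<in> edges C" "?V - e \<subseteq> ?V - f" for e f
  proof -
    have "f \<subseteq> e" using that(3) edge[OF that(2)] by auto
    then show ?thesis using assms that by (auto simp: is_clutter_def)
  qed
  show ?thesis
  proof (intro equalityI subsetI)
    fix F assume F: "F \<in> facets ?D"
    then obtain e where e: "e \<in> edges C" "F \<subseteq> ?V - e" by (auto simp: facets_def D)
    then have "?V - e \<in> ?D" by (auto simp: D)
    then have "F = ?V - e" using F e(2) by (auto simp: facets_def)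
    then show "F \<in> (\<lambda>e. ?V - e) ` edges C" using e(1) by auto
  next
    fix F assume "F \<in> (\<lambda>e. ?V - e) ` edges C"
    then obtain e where e: "e \<in> edges C" "F = ?V - e" by auto
    have "F = G" if "G \<in> ?D" "F \<subseteq> G" for G
    proof -
      obtain f where f: "f \<in> edges C" "G \<subseteq> ?V - f" using \<open>G \<in> ?D\<close> by (auto simp: D)
      then have "e = f" using anti e that(2) by auto
      then show ?thesis using e f that(2) by auto
    qed
    then show "F \<in> facets ?D" using e by (auto simp: facets_def D)
  qed
qed

end

theory Submission
  imports Defs
begin

text \<open>
  Taking complements turns the claim into one about the non-edges of \<open>C\<close>: they can be listed so
  that for \<open>e\<close> before \<open>f\<close> some \<open>g = f - {x} \<union> {y}\<close> with \<open>x \<in> f - e\<close> and \<open>y \<in> e - f\<close> also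
  comes before \<open>f\<close>. When a complete clutter on \<open>S\<close> is attached to \<open>K\<close>, the new non-edges are the
  \<open>d\<close>-sets meeting both \<open>S - verts K\<close> and \<open>verts K - S\<close>. These are the bases of a transversal
  matroid, and the bases of any matroid can be listed in this way. Put the new non-edges
  \<^emph>\<open>before\<close> those of \<open>K\<close>: a non-edge \<open>f\<close> of \<open>K\<close> is not contained in \<open>S\<close>, so an element of \<open>f\<close> can
  be exchanged for an element of \<open>S - verts K\<close> while keeping an element of \<open>verts K - S\<close>.
\<close>

section \<open>Exchange orders and basis exchange\<close>

definition exchange_step :: "'a set \<Rightarrow> 'a set \<Rightarrow> 'a set \<Rightarrow> bool" where
  "exchange_step e f g \<longleftrightarrow> card (g - f) = 1 \<and> e \<inter> f \<subseteq> g \<and> g \<subseteq> e \<union> f"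

definition exchange_orderable :: "'a set set \<Rightarrow> bool" where
  "exchange_orderable F \<longleftrightarrow>
     (\<exists>es. distinct es \<and> set es = F \<and>
       (\<forall>j<length es. \<forall>i<j. \<exists>k<j. exchange_step (es ! i) (es ! j) (es ! k)))"

lemma exchange_stepI:
  assumes "x \<in> f - e" "y \<in> e - f"
  shows "exchange_step e f (insert y (f - {x}))"
proof -
  have "insert y (f - {x}) - f = {y}" using assms by auto
  then show ?thesis using assms by (auto simp: exchange_step_def)
qed

lemma exchange_orderable_empty: "exchange_orderable {}"
  by (simp add: exchange_orderable_def)

lemma exchange_orderable_singleton: "exchange_orderable {e}"
  unfolding exchange_orderable_def by (intro exI[of _ "[e]"]) simp

text \<open>Concatenate the two orders. Only pairs with \<open>e\<close> from \<open>E\<close> and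
  \<open>f\<close> from \<open>F\<close> are new, and for them \<open>cross\<close> yields a
  \<open>g\<close> in \<open>E\<close>, hence before \<open>f\<close>.\<close>

lemma exchange_orderable_Un:
  assumes E: "exchange_orderable E" and F: "exchange_orderable F" and disj: "E \<inter> F = {}"
    and cross: "\<And>e f. e \<in> E \<Longrightarrow> f \<in> F \<Longrightarrow> \<exists>g\<in>E. exchange_step e f g"
  shows "exchange_orderable (E \<union> F)"
proof -
  obtain es where es: "distinct es" "set es = E"
    "\<And>i j. j < length es \<Longrightarrow> i < j \<Longrightarrow> \<exists>k<j. exchange_step (es ! i) (es ! j) (es ! k)"
    using E unfolding exchange_orderable_def by blast
  obtain fs where fs: "distinct fs" "set fs = F"
    "\<And>i j. j < length fs \<Longrightarrow> i < j \<Longrightarrow> \<exists>k<j. exchange_step (fs ! i) (fs ! j) (fs ! k)"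
    using F unfolding exchange_orderable_def by blast
  let ?n = "length es" and ?l = "es @ fs"
  have "\<exists>k<j. exchange_step (?l ! i) (?l ! j) (?l ! k)" if j: "j < length ?l" and i: "i < j" for i j
  proof (cases "j < ?n")
    case True
    then obtain k where "k < j" "exchange_step (es ! i) (es ! j) (es ! k)"
      using es(3) i by blast
    then show ?thesis using True i by (auto simp: nth_append intro!: exI[of _ k])
  next
    case False
    show ?thesis
    proof (cases "i < ?n")
      case True
      have "es ! i \<in> E" "fs ! (j - ?n) \<in> F" using es(2) fs(2) True False j by auto
      then obtain g where "g \<in> E" "exchange_step (es ! i) (fs ! (j - ?n)) g"
        using cross by blast
      moreover from \<open>g \<in> E\<close> obtain k where "k < ?n" "es ! k = g"
        using es(2) by (auto simp: in_set_conv_nth)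
      ultimately show ?thesis using True False by (auto simp: nth_append intro!: exI[of _ k])
    next
      case ge: False
      have "j - ?n < length fs" "i - ?n < j - ?n" using False ge i j by auto
      then obtain k where "k < j - ?n" "exchange_step (fs ! (i - ?n)) (fs ! (j - ?n)) (fs ! k)"
        using fs(3) by blast
      then show ?thesis using False ge by (auto simp: nth_append intro!: exI[of _ "?n + k"])
    qed
  qed
  moreover have "distinct ?l" "set ?l = E \<union> F" using es fs disj by auto
  ultimately show ?thesis unfolding exchange_orderable_def by blast
qed

text \<open>
  \<open>V\<close> is the set of elements on which members of \<open>F\<close> may still differ: for \<open>v \<in> V\<close>, list the
  members containing \<open>v\<close> before the others.
\<close>

lemma exchange_orderable_of_basis_exchange:
  assumes "finite V" and "\<And>e f. e \<in> F \<Longrightarrow> f \<in> F \<Longrightarrow> e - V = f - V"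
    and "\<And>e f y. e \<in> F \<Longrightarrow> f \<in> F \<Longrightarrow> y \<in> e - f \<Longrightarrow> \<exists>x\<in>f - e. insert y (f - {x}) \<in> F"
  shows "exchange_orderable F"
  using assms
proof (induction V arbitrary: F rule: finite_induct)
  case empty
  have "e = f" if "e \<in> F" "f \<in> F" for e f
    using empty.prems(1)[OF that] by simp
  then have "F = {} \<or> (\<exists>e. F = {e})" by blast
  then show ?case using exchange_orderable_empty exchange_orderable_singleton by auto
next
  case (insert v V)
  note agree = insert.prems(1) and exch = insert.prems(2)
  let ?E = "{e \<in> F. v \<in> e}" and ?G = "{e \<in> F. v \<notin> e}"
  have "exchange_orderable ?E"
  proof (rule insert.IH)
    show "e - V = f - V" if "e \<in> ?E" "f \<in> ?E" for e f
      using agree[of e f] that insert.hyps(2) by blast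
    show "\<exists>x\<in>f - e. insert y (f - {x}) \<in> ?E" if ef: "e \<in> ?E" "f \<in> ?E" "y \<in> e - f" for e f y
    proof -
      obtain x where "x \<in> f - e" "insert y (f - {x}) \<in> F"
        using exch[OF _ _ ef(3)] ef by auto
      \<comment> \<open>\<open>v\<close> lies in \<open>e\<close> and \<open>x\<close> does not, so
        removing \<open>x\<close> keeps \<open>v\<close>.\<close>
      then show ?thesis using ef by (intro bexI[of _ x]) auto
    qed
  qed
  moreover have "exchange_orderable ?G"
  proof (rule insert.IH)
    show "e - V = f - V" if "e \<in> ?G" "f \<in> ?G" for e f
      using agree[of e f] that insert.hyps(2) by blast
    show "\<exists>x\<in>f - e. insert y (f - {x}) \<in> ?G" if ef: "e \<in> ?G" "f \<in> ?G" "y \<in> e - f" for e f y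
    proof -
      obtain x where "x \<in> f - e" "insert y (f - {x}) \<in> F"
        using exch[OF _ _ ef(3)] ef by auto
      \<comment> \<open>\<open>y\<close> lies in \<open>e\<close> and \<open>v\<close> does not, so
        inserting \<open>y\<close> does not bring in \<open>v\<close>.\<close>
      then show ?thesis using ef by (intro bexI[of _ x]) auto
    qed
  qed
  moreover have "\<exists>g\<in>?E. exchange_step e f g" if ef: "e \<in> ?E" "f \<in> ?G" for e f
  proof -
    \<comment> \<open>Exchanging in \<open>v\<close> itself moves \<open>f\<close> into the earlier
      block.\<close>
    obtain x where "x \<in> f - e" "insert v (f - {x}) \<in> F" using exch[of e f v] ef by auto
    then show ?thesis
      using exchange_stepI[of x f e v] ef by (intro bexI[of _ "insert v (f - {x})"]) auto
  qed
  moreover have "?E \<inter> ?G = {}" "F = ?E \<union> ?G" by auto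
  ultimately show ?case using exchange_orderable_Un[of ?E ?G] by simp
qed

text \<open>
  An \<open>x \<in> f - e\<close> is unsuitable only if it is the sole element of \<open>f\<close> in \<open>P\<close> (or in \<open>Q\<close>); then \<open>e\<close>
  has an element \<open>\<noteq> y\<close> of the same class outside \<open>f\<close>. If all were unsuitable, \<open>f - e\<close> would
  inject into \<open>e - f - {y}\<close>.
\<close>

lemma exchange_meeting_both:
  assumes fin: "finite e" "finite f" and card: "card e = card f" and PQ: "P \<inter> Q = {}"
    and e: "e \<inter> P \<noteq> {}" "e \<inter> Q \<noteq> {}" and y: "y \<in> e - f"
    and f: "insert y f \<inter> P \<noteq> {}" "insert y f \<inter> Q \<noteq> {}"
  shows "\<exists>x\<in>f - e. insert y (f - {x}) \<inter> P \<noteq> {} \<and> insert y (f - {x}) \<inter> Q \<noteq> {}"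
proof (rule ccontr)
  assume neg: "\<not> ?thesis"
  have "\<exists>z\<in>e - f - {y}. (z \<in> P \<and> f \<inter> P = {x}) \<or> (z \<in> Q \<and> f \<inter> Q = {x})" if x: "x \<in> f - e" for x
  proof -
    consider "insert y (f - {x}) \<inter> P = {}" | "insert y (f - {x}) \<inter> Q = {}"
      using neg x by blast
    then show ?thesis
    proof cases
      case 1
      then have "y \<notin> P" "f \<inter> P = {x}" using f(1) by auto
      moreover obtain z where "z \<in> e" "z \<in> P" using e(1) by auto
      moreover have "z \<notin> f"
      proof
        assume "z \<in> f"
        then have "z \<in> {x}" using calculation by (metis IntI)
        then show False using x \<open>z \<in> e\<close> by simp
      qed
      ultimately show ?thesis by (intro bexI[of _ z]) auto
    next
      case 2
      then have "y \<notin> Q" "f \<inter> Q = {x}" using f(2) by auto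
      moreover obtain z where "z \<in> e" "z \<in> Q" using e(2) by auto
      moreover have "z \<notin> f"
      proof
        assume "z \<in> f"
        then have "z \<in> {x}" using calculation by (metis IntI)
        then show False using x \<open>z \<in> e\<close> by simp
      qed
      ultimately show ?thesis by (intro bexI[of _ z]) auto
    qed
  qed
  then obtain h where h: "\<And>x. x \<in> f - e \<Longrightarrow> h x \<in> e - f - {y}"
    "\<And>x. x \<in> f - e \<Longrightarrow> (h x \<in> P \<and> f \<inter> P = {x}) \<or> (h x \<in> Q \<and> f \<inter> Q = {x})"
    by metis
  have "inj_on h (f - e)"
  proof (rule inj_onI)
    fix a b assume "a \<in> f - e" "b \<in> f - e" "h a = h b"
    \<comment> \<open>As \<open>P\<close> and \<open>Q\<close> are disjoint, the common image
      determines one class, in which both \<open>a\<close> and \<open>b\<close> are the sole element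
      of \<open>f\<close>.\<close>
    then have "{a} = {b}" using h(2)[of a] h(2)[of b] PQ by (metis disjoint_iff)
    then show "a = b" by simp
  qed
  then have "card (f - e) \<le> card (e - f - {y})"
    using h(1) fin(1) by (intro card_inj_on_le[of h]) auto
  also have "\<dots> < card (e - f)" using y fin(1) by (intro card_Diff1_less) auto
  also have "\<dots> = card (f - e)"
    using card card_Int_Diff[OF fin(1), of f] card_Int_Diff[OF fin(2), of e]
    by (simp add: Int_commute)
  finally show False by simp
qed

section \<open>Non-edges of E-chordal clutters\<close>

lemma e_chordal_finite_verts: "e_chordal d C \<Longrightarrow> finite (verts C)"
  by (induction rule: e_chordal.induct) (auto simp: complete_clutter_def clutter_union_def)

lemma e_chordal_edges: "e_chordal d C \<Longrightarrow> e \<in> edges C \<Longrightarrow> e \<subseteq> verts C"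
  by (induction arbitrary: e rule: e_chordal.induct) (auto simp: complete_clutter_def clutter_union_def)

lemma exchange_orderable_d_complement:
  assumes "e_chordal d C"
  shows "exchange_orderable (edges (d_complement d C))"
  using assms
proof (induction rule: e_chordal.induct)
  case (complete S)
  have "edges (d_complement d (complete_clutter d S)) = {}"
    by (auto simp: d_complement_def complete_clutter_def)
  then show ?case using exchange_orderable_empty by simp
next
  case (attach K S)
  let ?A = "verts K" and ?N = "edges (d_complement d K)"
  let ?P = "S - ?A" and ?Q = "?A - S"
  define M where "M = {e. e \<subseteq> ?A \<union> S \<and> card e = d \<and> e \<inter> ?P \<noteq> {} \<and> e \<inter> ?Q \<noteq> {}}"
  have fin: "finite (?A \<union> S)" using e_chordal_finite_verts attach.hyps(1,2) by auto
  have N: "e \<subseteq> ?A \<and> card e = d \<and> e \<notin> edges K \<and> e \<inter> ?Q \<noteq> {}" if "e \<in> ?N" for e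
  proof -
    have e: "e \<subseteq> ?A" "card e = d" "e \<notin> edges K" using that by (auto simp: d_complement_def)
    \<comment> \<open>The gluing hypothesis makes every \<open>d\<close>-subset of
      \<open>?A \<inter> S\<close> an edge of \<open>K\<close>.\<close>
    have "\<not> e \<subseteq> ?A \<inter> S"
    proof
      assume "e \<subseteq> ?A \<inter> S"
      then have "e \<in> edges (induced_clutter K (?A \<inter> S))"
        unfolding attach.hyps(3) using e(2) by (simp add: complete_clutter_def)
      then show False using e(3) by (simp add: induced_clutter_def)
    qed
    then show ?thesis using e by auto
  qed
  \<comment> \<open>Only \<open>insert y f\<close> is asked to meet both sides, so this covers
    \<open>f\<close> in \<open>M\<close> as well as the non-edges \<open>f\<close> of
    \<open>K\<close>, which miss \<open>?P\<close>.\<close>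
  have exch: "\<exists>x\<in>f - e. insert y (f - {x}) \<in> M"
    if e: "e \<in> M" and f: "f \<subseteq> ?A \<union> S" "card f = d" and y: "y \<in> e - f"
      and yf: "insert y f \<inter> ?P \<noteq> {}" "insert y f \<inter> ?Q \<noteq> {}" for e f y
  proof -
    have eM: "e \<subseteq> ?A \<union> S" "card e = d" "e \<inter> ?P \<noteq> {}" "e \<inter> ?Q \<noteq> {}"
      using e by (auto simp: M_def)
    have fe: "finite e" "finite f" using eM(1) f(1) fin by (auto dest: finite_subset)
    obtain x where x: "x \<in> f - e" "insert y (f - {x}) \<inter> ?P \<noteq> {}" "insert y (f - {x}) \<inter> ?Q \<noteq> {}"
      using exchange_meeting_both[OF fe _ _ eM(3,4) y yf] eM(2) f(2) by auto
    have "card (insert y (f - {x})) = d"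
      using x(1) y fe(2) f(2) card_Suc_Diff1[of f x] by simp
    moreover have "insert y (f - {x}) \<subseteq> ?A \<union> S" using eM(1) f(1) y by auto
    ultimately have "insert y (f - {x}) \<in> M" using x(2,3) by (simp add: M_def)
    then show ?thesis using x(1) by blast
  qed
  have "exchange_orderable M"
  proof (rule exchange_orderable_of_basis_exchange[OF fin])
    show "e - (?A \<union> S) = f - (?A \<union> S)" if "e \<in> M" "f \<in> M" for e f
      using that unfolding M_def by blast
    show "\<exists>x\<in>f - e. insert y (f - {x}) \<in> M" if "e \<in> M" "f \<in> M" "y \<in> e - f" for e f y
      using that(2) by (intro exch[OF that(1) _ _ that(3)]) (auto simp: M_def)
  qed
  moreover have "\<exists>g\<in>M. exchange_step e f g" if e: "e \<in> M" and f: "f \<in> ?N" for e f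
  proof -
    \<comment> \<open>Any \<open>y\<close> in \<open>?P\<close> works: it is outside
      \<open>f \<subseteq> ?A\<close> and supplies the element of \<open>?P\<close>, while
      \<open>f\<close> already meets \<open>?Q\<close>.\<close>
    obtain y where y: "y \<in> e" "y \<in> ?P" using e by (auto simp: M_def)
    have "y \<in> e - f" using y N[OF f] by auto
    moreover have "\<exists>x\<in>f - e. insert y (f - {x}) \<in> M"
      using y N[OF f] by (intro exch[OF e]) auto
    ultimately show ?thesis using exchange_stepI by metis
  qed
  moreover have "M \<inter> ?N = {}" using N by (auto simp: M_def)
  moreover have "edges (d_complement d (clutter_union K (complete_clutter d S))) = M \<union> ?N"
  proof (intro equalityI subsetI)
    fix e assume "e \<in> edges (d_complement d (clutter_union K (complete_clutter d S)))"
    \<comment> \<open>\<open>e\<close> is not inside \<open>S\<close>, where all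
      \<open>d\<close>-sets are edges. Inside \<open>?A\<close> it is a non-edge of
      \<open>K\<close>; otherwise it meets both \<open>?P\<close> and \<open>?Q\<close>.\<close>
    then show "e \<in> M \<union> ?N"
      by (auto simp: d_complement_def clutter_union_def complete_clutter_def M_def)
  next
    fix e assume e: "e \<in> M \<union> ?N"
    \<comment> \<open>Every such \<open>e\<close> meets \<open>?Q\<close>, so it is no edge of the
      attached clutter; members of \<open>M\<close> also meet \<open>?P\<close>, so they are no
      edges of \<open>K\<close>.\<close>
    have "\<not> e \<subseteq> S" using e N[of e] by (auto simp: M_def)
    moreover have "e \<notin> edges K"
      using e N[of e] e_chordal_edges[OF attach.hyps(1), of e] by (auto simp: M_def)
    moreover have "e \<subseteq> ?A \<union> S" "card e = d" using e N[of e] by (auto simp: M_def)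
    ultimately show "e \<in> edges (d_complement d (clutter_union K (complete_clutter d S)))"
      by (simp add: d_complement_def clutter_union_def complete_clutter_def)
  qed
  ultimately show ?case using exchange_orderable_Un[of M ?N] attach.IH by simp
qed

section \<open>Passage to the Alexander dual\<close>

lemma strongly_shellable_dual_independence_complex:
  assumes C: "is_clutter C" and ord: "exchange_orderable (edges C)"
  shows "strongly_shellable (alexander_dual (verts C) (independence_complex C))"
proof -
  let ?V = "verts C"
  obtain es where es: "distinct es" "set es = edges C"
    "\<And>i j. j < length es \<Longrightarrow> i < j \<Longrightarrow> \<exists>k<j. exchange_step (es ! i) (es ! j) (es ! k)"
    using ord unfolding exchange_orderable_def by blast
  have sub: "es ! i \<subseteq> ?V" if "i < length es" for i
    using es(2) that C nth_mem[OF that] by (auto simp: is_clutter_def)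
  let ?Fs = "map (\<lambda>e. ?V - e) es"
  have "inj_on (\<lambda>e. ?V - e) (edges C)"
    using C unfolding is_clutter_def by (metis double_diff inj_onI order_refl)
  then have "distinct ?Fs" using es by (simp add: distinct_map)
  moreover have "set ?Fs = facets (alexander_dual ?V (independence_complex C))"
    using facets_dual_independence_complex[OF C] es(2) by simp
  moreover have "\<exists>k<j. card (?Fs ! j - ?Fs ! k) = 1 \<and>
      ?Fs ! i \<inter> ?Fs ! j \<subseteq> ?Fs ! k \<and> ?Fs ! k \<subseteq> ?Fs ! i \<union> ?Fs ! j"
    if j: "j < length ?Fs" and i: "i < j" for i j
  proof -
    obtain k where k: "k < j" "exchange_step (es ! i) (es ! j) (es ! k)"
      using es(3) i j by auto
    \<comment> \<open>Complementing in \<open>?V\<close> reverses set differences and swaps the two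
      inclusions of \<open>exchange_step\<close>.\<close>
    have "?Fs ! j - ?Fs ! k = es ! k - es ! j" using sub[of k] k(1) j by auto
    then show ?thesis using k i j by (intro exI[of _ k]) (auto simp: exchange_step_def)
  qed
  ultimately show ?thesis unfolding strongly_shellable_def by blast
qed

lemma is_clutter_d_complement:
  assumes "finite (verts C)" "d \<ge> 1"
  shows "is_clutter (d_complement d C)"
proof -
  have "e = f" if "e \<subseteq> f" "f \<subseteq> verts C" "card e = card f" for e f
    using that assms(1) by (metis card_subset_eq finite_subset)
  then show ?thesis using assms by (auto simp: is_clutter_def d_complement_def)
qed

theorem theorem3p5:
  fixes C :: "'a clutter" and d :: nat
  assumes "d \<ge> 1" and "e_chordal d C"
  shows "strongly_shellable
           (alexander_dual (verts C) (independence_complex (d_complement d C)))"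
proof -
  have "verts (d_complement d C) = verts C" by (simp add: d_complement_def)
  then show ?thesis
    using strongly_shellable_dual_independence_complex[of "d_complement d C"]
      is_clutter_d_complement[OF e_chordal_finite_verts[OF assms(2)] assms(1)]
      exchange_orderable_d_complement[OF assms(2)] by simp
qed

end
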